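(* Let $m, n, M$ be positive integers with $n \ge 5$, and let $\ell_1, w_1 \in \mathbb{Z}^m$, $\ell_2, w_2 \in \mathbb{Z}^n$ be integral vectors with $w_2 > \ell_2$ (componentwise). For a matrix $A$ let (IP) be the problem: find $x \in Q \cap \mathbb{Z}^n$, where $Q = \{x \in \mathbb{R}^n : \ell_1 \le Ax \le w_1,\ \ell_2 \le x \le w_2\}$. (1) If $$M > \big(2^{(n+4)/2}\, \|(w_1;w_2)-(\ell_1;\ell_2)\|\big)^{n/m+1},$$ then for almost all $A \in G_{m,n}(M)$ reverse branch-and-bound solves the LLL-rangespace reformulation of (IP) at the rootnode. (2) Suppose in addition that $m \le n$, $w_1 = \ell_1$ and $\chi_{m,n}(M) \ge 1/2$. If $$M > \big(2^{(n-m+4)/2}\, \|w_2-\ell_2\|\big)^{n/m},$$ then for almost all $A \in G'_{m,n}(M)$ reverse branch-and-bound solves the LLL-nullspace reformulation of (IP) at the rootnode.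
   Context: Norms are Euclidean, $I$ is the identity matrix, and $(A;B)$ denotes the matrix (or vector) obtained by stacking $A$ on top of $B$. Matrix sets. $G_{m,n}(M)$ is the set of $m\times n$ matrices with entries in $\{1,\dots,M\}$; $G'_{m,n}(M)$ is the subset of those with linearly independent rows; $\chi_{m,n}(M) = |G'_{m,n}(M)|/|G_{m,n}(M)|$. A statement is true for almost all elements of a finite set $S$ if it holds for all but at most a fraction $1/2^n$ of the elements of $S$ (with $n$ the number of columns of $A$). Lattices and LLL reduction. A lattice is $L = \mathbb{L}(B) = \{Bx : x \in \mathbb{Z}^r\}$, with $B$ a real matrix with $r$ linearly independent columns $b_1,\dots,b_r$ (a basis of $L$). The Gram-Schmidt vectors are $b_1^* = b_1$ and $b_i^*$ = the projection of $b_i$ onto the orthogonal complement of the span of $b_1,\dots,b_{i-1}$; $\mu_{ij} = \langle b_i,b_j^*\rangle/\|b_j^*\|^2$ for $j<i$. The basis is LLL-reduced if $|\mu_{ij}|\le \frac12$ for $1\le j<i\le r$ and $\|\mu_{i,i-1}b_{i-1}^*+b_i^*\|^2\ge\frac34\|b_{i-1}^*\|^2$ for $1<i\le r$. Reformulations. The LLL-rangespace reformulation of (IP) is: find $y \in Q_R \cap \mathbb{Z}^n$, where $Q_R = \{y \in \mathbb{R}^n : (\ell_1;\ell_2) \le (A;I)Uy \le (w_1;w_2)\}$ and $U$ is a unimodular matrix such that the columns of $(A;I)U$ form an LLL-reduced basis of $\mathbb{L}((A;I))$. The LLL-nullspace reformulation is applicable when the rows of $A$ are linearly independent and $w_1 =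 \ell_1$; it is: find $y \in Q_N\cap\mathbb{Z}^{n-m}$, where $Q_N = \{y \in \mathbb{R}^{n-m} : \ell_2 - x_0 \le By \le w_2 - x_0\}$, $x_0\in\mathbb{Z}^n$ satisfies $Ax_0=\ell_1$, and the columns of $B$ are an LLL-reduced basis of $\{x\in\mathbb{Z}^n : Ax=0\}$. (If no such $x_0$ exists, (IP) is infeasible and there is no reformulated problem to solve; if $m=n$ there are no variables to branch on.) The assertions are for any admissible choice of $U$, $B$, $x_0$. Branch-and-bound. Reverse branch-and-bound applied to a polyhedron $P\subset\mathbb{R}^r$ in variables $y_1,\dots,y_r$ starts with $P$ as the sole subproblem and branches on the variables in the order $y_r, y_{r-1},\dots,y_1$: branching on $y_i$ in a subproblem $P'$ creates the nodes $P'\cap\{y : y_i=\gamma\}$, where $\gamma$ ranges over all integers with $\min\{y_i : y\in P'\}\le\gamma\le\max\{y_i : y\in P'\}$ (no nodes if $P'$ is empty). This is repeated until all subproblems are shown to be empty or an integral point is found. The nodes created by branching on $y_i$ form the level of $y_i$. Branch-and-bound solves the problem at the rootnode if it generates at most one node at each level of the tree. *)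

theory Defs
  imports
    Complex_Main
    "Jordan_Normal_Form.Determinant"
    "Jordan_Normal_Form.Gram_Schmidt"
begin

definition vnorm :: "real vec \<Rightarrow> real" where
  "vnorm v = sqrt (v \<bullet> v)"

text \<open>Linear independence of a family: the library predicate is about sets, so repeated
  vectors have to be excluded separately.\<close>

definition lin_indep_vecs :: "nat \<Rightarrow> real vec list \<Rightarrow> bool" where
  "lin_indep_vecs d vs \<longleftrightarrow>
     distinct vs \<and> \<not> LinearCombinations.module.lin_dep class_ring (module_vec TYPE(real) d) (set vs)"

definition G_mats :: "nat \<Rightarrow> nat \<Rightarrow> nat \<Rightarrow> int mat set" where
  "G_mats m n M = {A \<in> carrier_mat m n. \<forall>i<m. \<forall>j<n. A $$ (i, j) \<in> {1..int M}}"

definition G'_mats :: "nat \<Rightarrow> nat \<Rightarrow> nat \<Rightarrow> int mat set" where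
  "G'_mats m n M = {A \<in> G_mats m n M. lin_indep_vecs n (rows (map_mat real_of_int A))}"

definition chi :: "nat \<Rightarrow> nat \<Rightarrow> nat \<Rightarrow> real" where
  "chi m n M = real (card (G'_mats m n M)) / real (card (G_mats m n M))"

definition almost_all :: "nat \<Rightarrow> 'a set \<Rightarrow> ('a \<Rightarrow> bool) \<Rightarrow> bool" where
  "almost_all n S P \<longleftrightarrow> real (card {A \<in> S. \<not> P A}) \<le> real (card S) / 2 ^ n"


definition lattice_of :: "real mat \<Rightarrow> real vec set" where
  "lattice_of B = {B *\<^sub>v map_vec real_of_int x | x. x \<in> carrier_vec (dim_col B)}"

definition lattice_basis :: "real mat \<Rightarrow> real vec set \<Rightarrow> bool" where
  "lattice_basis B L \<longleftrightarrow> lin_indep_vecs (dim_row B) (cols B) \<and> lattice_of B = L"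

text \<open>Columns are numbered from \<open>0\<close>. The library orthogonalisation does not normalise, and
  over the reals its conjugated inner product is the ordinary one.\<close>

definition gs :: "real mat \<Rightarrow> nat \<Rightarrow> real vec" where
  "gs B i = gram_schmidt (dim_row B) (cols B) ! i"

definition gs_mu :: "real mat \<Rightarrow> nat \<Rightarrow> nat \<Rightarrow> real" where
  "gs_mu B i j = (col B i \<bullet> gs B j) / (vnorm (gs B j))\<^sup>2"

definition LLL_reduced :: "real mat \<Rightarrow> bool" where
  "LLL_reduced B \<longleftrightarrow>
     (\<forall>i<dim_col B. \<forall>j<i. \<bar>gs_mu B i j\<bar> \<le> 1 / 2) \<and>
     (\<forall>i. 0 < i \<and> i < dim_col B \<longrightarrow>
        (vnorm (gs_mu B i (i - 1) \<cdot>\<^sub>v gs B (i - 1) + gs B i))\<^sup>2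
          \<ge> 3 / 4 * (vnorm (gs B (i - 1)))\<^sup>2)"

definition unimodular :: "nat \<Rightarrow> int mat \<Rightarrow> bool" where
  "unimodular n U \<longleftrightarrow> U \<in> carrier_mat n n \<and> (det U = 1 \<or> det U = - 1)"


definition stack_id :: "int mat \<Rightarrow> int mat" where
  "stack_id A = A @\<^sub>r 1\<^sub>m (dim_col A)"

definition rangespace_admissible :: "int mat \<Rightarrow> int mat \<Rightarrow> bool" where
  "rangespace_admissible A U \<longleftrightarrow>
     unimodular (dim_col A) U \<and>
     lattice_basis (map_mat real_of_int (stack_id A * U))
       (lattice_of (map_mat real_of_int (stack_id A))) \<and>
     LLL_reduced (map_mat real_of_int (stack_id A * U))"

definition rangespace_polyhedron ::
  "int mat \<Rightarrow> int vec \<Rightarrow> int vec \<Rightarrow> int vec \<Rightarrow> int vec \<Rightarrow> int mat \<Rightarrow> real vec set" where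
  "rangespace_polyhedron A l1 w1 l2 w2 U =
     {y \<in> carrier_vec (dim_col A).
        map_vec real_of_int (l1 @\<^sub>v l2) \<le> map_mat real_of_int (stack_id A * U) *\<^sub>v y \<and>
        map_mat real_of_int (stack_id A * U) *\<^sub>v y \<le> map_vec real_of_int (w1 @\<^sub>v w2)}"

definition integer_kernel :: "int mat \<Rightarrow> real vec set" where
  "integer_kernel A =
     {map_vec real_of_int x | x. x \<in> carrier_vec (dim_col A) \<and> A *\<^sub>v x = 0\<^sub>v (dim_row A)}"

text \<open>For \<open>A\<close> with linearly independent rows, so that the kernel lattice has rank
  \<open>dim_col A - dim_row A\<close>.\<close>

definition nullspace_admissible :: "int mat \<Rightarrow> int vec \<Rightarrow> real mat \<Rightarrow> int vec \<Rightarrow> bool" where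
  "nullspace_admissible A l1 B x0 \<longleftrightarrow>
     B \<in> carrier_mat (dim_col A) (dim_col A - dim_row A) \<and>
     lattice_basis B (integer_kernel A) \<and> LLL_reduced B \<and>
     x0 \<in> carrier_vec (dim_col A) \<and> A *\<^sub>v x0 = l1"

definition nullspace_polyhedron ::
  "int vec \<Rightarrow> int vec \<Rightarrow> real mat \<Rightarrow> int vec \<Rightarrow> real vec set" where
  "nullspace_polyhedron l2 w2 B x0 =
     {y \<in> carrier_vec (dim_col B).
        map_vec real_of_int (l2 - x0) \<le> B *\<^sub>v y \<and> B *\<^sub>v y \<le> map_vec real_of_int (w2 - x0)}"


text \<open>The integers \<open>\<gamma>\<close> for which branching on the \<open>i\<close>-th variable (numbered from \<open>0\<close>) in the
  subproblem \<open>P\<close> creates a node. The polyhedra of interest are bounded, hence compact, so the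
  infimum and the supremum are the minimum and the maximum.\<close>

definition branch_values :: "nat \<Rightarrow> real vec set \<Rightarrow> int set" where
  "branch_values i P =
     {\<gamma>. P \<noteq> {} \<and> (INF y\<in>P. y $ i) \<le> real_of_int \<gamma> \<and> real_of_int \<gamma> \<le> (SUP y\<in>P. y $ i)}"

text \<open>A node is a subproblem together with the list of values fixed on the way to it (last fixed
  value first). Level \<open>0\<close> is the root; level \<open>Suc k\<close> is obtained by branching on variable
  \<open>r - Suc k\<close>, so the \<open>r\<close> variables are treated from the last to the first.
  An integral point is only found once all variables are fixed, so a subproblem is pruned only if
  it is empty.\<close>

fun bb_level :: "nat \<Rightarrow> real vec set \<Rightarrow> nat \<Rightarrow> (int list \<times> real vec set) set" where
  "bb_level r P 0 = {([], P)}"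
| "bb_level r P (Suc k) =
     {(\<gamma> # \<gamma>s, P' \<inter> {y. y $ (r - Suc k) = real_of_int \<gamma>}) | \<gamma> \<gamma>s P'.
        (\<gamma>s, P') \<in> bb_level r P k \<and> \<gamma> \<in> branch_values (r - Suc k) P'}"

definition solved_at_rootnode :: "nat \<Rightarrow> real vec set \<Rightarrow> bool" where
  "solved_at_rootnode r P \<longleftrightarrow>
     (\<forall>k\<in>{1..r}. finite (bb_level r P k) \<and> card (bb_level r P k) \<le> 1)"

definition rangespace_solved_at_rootnode ::
  "int vec \<Rightarrow> int vec \<Rightarrow> int vec \<Rightarrow> int vec \<Rightarrow> int mat \<Rightarrow> bool" where
  "rangespace_solved_at_rootnode l1 w1 l2 w2 A \<longleftrightarrow>
     (\<forall>U. rangespace_admissible A U \<longrightarrow>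
        solved_at_rootnode (dim_col A) (rangespace_polyhedron A l1 w1 l2 w2 U))"

definition nullspace_solved_at_rootnode ::
  "int vec \<Rightarrow> int vec \<Rightarrow> int vec \<Rightarrow> int mat \<Rightarrow> bool" where
  "nullspace_solved_at_rootnode l1 l2 w2 A \<longleftrightarrow>
     (\<forall>B x0. nullspace_admissible A l1 B x0 \<longrightarrow>
        solved_at_rootnode (dim_col A - dim_row A) (nullspace_polyhedron l2 w2 B x0))"

end

theory Submission
  imports Defs "HOL-Library.FuncSet"
begin

text \<open>If two points of the polyhedron agree in the coordinates after \<open>i\<close>, the difference of their
  images under \<open>B\<close> has component \<open>(y $ i - y' $ i) \<cdot> gs B i\<close> along \<open>gs B i\<close>, so branching on \<open>y $ i\<close>
  creates at most one node as soon as \<open>gs B i\<close> is longer than the diagonal of the box. In an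
  LLL-reduced basis the squared Gram-Schmidt lengths at most halve from one index to the next, so this
  only fails if the first basis vector is short. Hence a bad \<open>A\<close> maps some short nonzero integer vector
  \<open>x\<close> to a short integer vector \<open>y\<close> (to \<open>0\<close> in the nullspace case), and for each such pair only a
  fraction \<open>1 / M ^ m\<close> of all matrices satisfies \<open>A *\<^sub>v x = y\<close>.\<close>

section \<open>Gram-Schmidt vectors and LLL-reduced bases\<close>

lemma conjugate_real_vec [simp]: "conjugate (v :: real vec) = v"
  by (intro eq_vecI) auto

text \<open>Unrolls the library recursion, which passes the vectors already produced in an
  accumulator, latest first. This exhibits each output as the original vector plus a correction
  built from its predecessors.\<close>

lemma gram_schmidt_sub2_nth:
  "i < length ws \<Longrightarrow> gram_schmidt_sub2 n us ws ! i =
     adjuster n (ws ! i) (rev (take i (gram_schmidt_sub2 n us ws)) @ us) + ws ! i"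
proof (induction ws arbitrary: us i)
  case (Cons w ws)
  then show ?case by (cases i) (auto simp: Let_def)
qed simp

text \<open>The correction is a linear combination of \<open>us\<close> and so inherits their
  orthogonality to \<open>x\<close>.\<close>

lemma adjuster_orthogonal:
  fixes x :: "real vec"
  assumes "set us \<subseteq> carrier_vec n" "x \<in> carrier_vec n" "\<And>u. u \<in> set us \<Longrightarrow> u \<bullet> x = 0"
  shows "adjuster n w us \<in> carrier_vec n \<and> adjuster n w us \<bullet> x = 0"
  using assms
proof (induction us)
  case (Cons u us)
  then have "adjuster n w us \<in> carrier_vec n \<and> adjuster n w us \<bullet> x = 0" by auto
  with Cons.prems show ?case
    by (auto simp: add_scalar_prod_distrib[of _ n])
qed simp

text \<open>\<open>gs B i\<close> differs from \<open>col B i\<close> by a combination of the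
  earlier \<open>gs B k\<close>, \<open>k < i\<close>. For \<open>i \<le> j\<close> all of these are
  orthogonal to \<open>gs B j\<close>, whence \<open>col_scalar_prod_gs\<close>: the product is 0
  for \<open>i < j\<close> and the squared length of \<open>gs B i\<close> for
  \<open>i = j\<close>.\<close>

lemma
  assumes B: "B \<in> carrier_mat N r" and li: "lin_indep_vecs N (cols B)"
  shows gs_carrier: "i < r \<Longrightarrow> gs B i \<in> carrier_vec N"
    and gs_orthogonal: "i < r \<Longrightarrow> j < r \<Longrightarrow> i \<noteq> j \<Longrightarrow> gs B i \<bullet> gs B j = 0"
    and col_scalar_prod_gs: "i \<le> j \<Longrightarrow> j < r \<Longrightarrow> col B i \<bullet> gs B j = gs B i \<bullet> gs B j"
    and gs_0: "0 < r \<Longrightarrow> gs B 0 = col B 0"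
    and col_nonzero: "i < r \<Longrightarrow> col B i \<noteq> 0\<^sub>v N"
proof -
  interpret cof_vec_space N "TYPE(real)" .
  define us where "us = gram_schmidt N (cols B)"
  have len: "length (cols B) = r" and c: "set (cols B) \<subseteq> carrier_vec N"
    using B cols_dim[of B] by auto
  have dist: "distinct (cols B)" and ind: "\<not> lin_dep (set (cols B))"
    using li by (auto simp: lin_indep_vecs_def)
  note res = gram_schmidt_result[OF c dist ind us_def]
  have gs: "gs B i = us ! i" for i using B by (simp add: gs_def us_def)
  show carr: "gs B i \<in> carrier_vec N" if "i < r" for i
    unfolding gs using res(3,4) len that nth_mem[of i us] by auto
  show orth: "gs B i \<bullet> gs B j = 0" if "i < r" "j < r" "i \<noteq> j" for i j
    using corthogonalD[OF res(2), of i j] that len res(4) by (simp add: gs)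
  have colc: "col B i \<in> carrier_vec N" for i using B by auto
  show "col B i \<bullet> gs B j = gs B i \<bullet> gs B j" if ij: "i \<le> j" "j < r" for i j
  proof -
    let ?a = "adjuster N (col B i) (rev (take i us))"
    have eq: "gs B i = ?a + col B i"
      using gram_schmidt_sub2_nth[of i "cols B" N "[]"] ij len B
      by (simp add: gs us_def gram_schmidt_code)
    have "\<exists>k<i. u = gs B k" if "u \<in> set (take i us)" for u
      using that by (auto simp: in_set_conv_nth gs)
    then have "?a \<in> carrier_vec N \<and> ?a \<bullet> gs B j = 0"
      by (intro adjuster_orthogonal) (use ij carr orth in \<open>auto, fastforce+\<close>)
    then show ?thesis
      using colc[of i] carr[of j] ij unfolding eq by (simp add: add_scalar_prod_distrib[of _ N])
  qed
  show "gs B 0 = col B 0" if "0 < r"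
    using gram_schmidt_sub2_nth[of 0 "cols B" N "[]"] that len B
    by (simp add: gs us_def gram_schmidt_code)
  show "col B i \<noteq> 0\<^sub>v N" if "i < r"
  proof -
    have "0\<^sub>v N \<notin> set (cols B)" using vs_zero_lin_dep[OF c ind] by auto
    moreover have "col B i \<in> set (cols B)" using that B by (auto simp: cols_def)
    ultimately show ?thesis by metis
  qed
qed

lemma vnorm_sq: "(vnorm v)\<^sup>2 = v \<bullet> v"
  unfolding vnorm_def by (simp add: scalar_prod_def sum_nonneg)

text \<open>For consecutive Gram-Schmidt vectors g, h orthogonality turns the second condition of
  reducedness into 3/4 |g|^2 \<le> \<mu>^2 |g|^2 + |h|^2. With \<mu>^2 \<le> 1/4 this gives |g|^2
  \<le> 2 |h|^2, and these inequalities are chained from index 0.\<close>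

lemma LLL_col_0_bound:
  assumes B: "B \<in> carrier_mat N r" and li: "lin_indep_vecs N (cols B)" and LLL: "LLL_reduced B"
  shows "i < r \<Longrightarrow> col B 0 \<bullet> col B 0 \<le> 2 ^ i * (gs B i \<bullet> gs B i)"
proof (induction i)
  case 0
  then show ?case using gs_0[OF B li] by simp
next
  case (Suc i)
  let ?\<mu> = "gs_mu B (Suc i) i" and ?g = "gs B i" and ?h = "gs B (Suc i)"
  have c: "?g \<in> carrier_vec N" "?h \<in> carrier_vec N" using gs_carrier[OF B li] Suc.prems by auto
  have o: "?g \<bullet> ?h = 0" "?h \<bullet> ?g = 0" using gs_orthogonal[OF B li] Suc.prems by auto
  have "\<bar>?\<mu>\<bar> \<le> 1 / 2"
    using LLL Suc.prems B by (auto simp: LLL_reduced_def)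
  then have mu: "?\<mu>\<^sup>2 \<le> 1 / 4" using power_mono[of "\<bar>?\<mu>\<bar>" "1/2" 2] by (simp add: power2_eq_square)
  have "3 / 4 * (vnorm ?g)\<^sup>2 \<le> (vnorm (?\<mu> \<cdot>\<^sub>v ?g + ?h))\<^sup>2"
    using LLL Suc.prems B unfolding LLL_reduced_def by fastforce
  also have "\<dots> = ?\<mu>\<^sup>2 * (?g \<bullet> ?g) + ?h \<bullet> ?h"
    using c o unfolding vnorm_sq
    by (simp add: add_scalar_prod_distrib[of _ N] scalar_prod_add_distrib[of _ N] power2_eq_square)
  finally have "3 / 4 * (?g \<bullet> ?g) \<le> 1 / 4 * (?g \<bullet> ?g) + ?h \<bullet> ?h"
    using mult_right_mono[OF mu, of "?g \<bullet> ?g"] by (simp add: vnorm_sq scalar_prod_def sum_nonneg)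
  then have "?g \<bullet> ?g \<le> 2 * (?h \<bullet> ?h)" by simp
  then have "2 ^ i * (?g \<bullet> ?g) \<le> 2 ^ Suc i * (?h \<bullet> ?h)" by simp
  then show ?case using Suc by linarith
qed

text \<open>Since \<open>z\<close> vanishes after \<open>i\<close> and the columns before
  \<open>i\<close> are orthogonal to \<open>gs B i\<close>, only column \<open>i\<close> contributes
  to the component of the image along \<open>gs B i\<close>. The left-hand side is the squared
  length of that component.\<close>

lemma coordinate_bound:
  fixes z :: "real vec"
  assumes B: "B \<in> carrier_mat N r" and li: "lin_indep_vecs N (cols B)"
    and z: "z \<in> carrier_vec r" and i: "i < r" and zero: "\<And>j. i < j \<Longrightarrow> j < r \<Longrightarrow> z $ j = 0"
  shows "(z $ i)\<^sup>2 * (gs B i \<bullet> gs B i) \<le> (B *\<^sub>v z) \<bullet> (B *\<^sub>v z)"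
proof -
  let ?g = "gs B i" and ?v = "B *\<^sub>v z"
  note g = gs_carrier[OF B li i]
  have v: "?v \<in> carrier_vec N" using B z by auto
  have "?g \<bullet> ?v = (transpose_mat B *\<^sub>v ?g) \<bullet> z"
    using transpose_vec_mult_scalar[OF B z g] by simp
  also have "\<dots> = (\<Sum>j<r. (col B j \<bullet> ?g) * z $ j)"
    using B z by (simp add: scalar_prod_def[of _ z] atLeast0LessThan)
  also have "\<dots> = (\<Sum>j\<in>{i}. (col B j \<bullet> ?g) * z $ j)"
  proof (rule sum.mono_neutral_right)
    show "\<forall>j\<in>{..<r} - {i}. (col B j \<bullet> ?g) * z $ j = 0"
    proof
      fix j assume "j \<in> {..<r} - {i}"
      then consider "j < i" | "i < j" "j < r" by fastforce
      then show "(col B j \<bullet> ?g) * z $ j = 0"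
        using col_scalar_prod_gs[OF B li, of j i] gs_orthogonal[OF B li, of j i] i zero by cases auto
    qed
  qed (use i in auto)
  also have "\<dots> = z $ i * (?g \<bullet> ?g)" using col_scalar_prod_gs[OF B li, of i i] i by simp
  finally have gv: "?g \<bullet> ?v = z $ i * (?g \<bullet> ?g)" .
  \<comment> \<open>This is the image minus its projection onto \<open>gs B i\<close>; its
    nonnegative squared norm yields the bound without a division by the squared length of
    \<open>gs B i\<close>.\<close>
  let ?d = "?v - z $ i \<cdot>\<^sub>v ?g"
  have "0 \<le> ?d \<bullet> ?d" by (simp add: scalar_prod_def sum_nonneg)
  also have "?d \<bullet> ?d = ?v \<bullet> ?v - (z $ i)\<^sup>2 * (?g \<bullet> ?g)"
    using v g gv comm_scalar_prod[OF v g]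
    by (simp add: minus_scalar_prod_distrib[of _ N] scalar_prod_minus_distrib[of _ N] power2_eq_square
        algebra_simps)
  finally show ?thesis by simp
qed

section \<open>Branch-and-bound on polyhedra of small width\<close>

text \<open>The supremum is at most the infimum plus \<delta>, so the branching values lie in an
  interval shorter than 1. The bound \<delta> is uniform because differences merely below 1 would
  still allow an interval of length 1, which can hold two integers.\<close>

lemma branch_values_unique:
  assumes osc: "\<And>y y'. y \<in> P \<Longrightarrow> y' \<in> P \<Longrightarrow> \<bar>y $ i - y' $ i\<bar> \<le> \<delta>" and "\<delta> < 1"
    and "\<gamma> \<in> branch_values i P" "\<gamma>' \<in> branch_values i P"
  shows "\<gamma> = \<gamma>'"
proof -
  have ne: "P \<noteq> {}" using assms by (auto simp: branch_values_def)
  have "y $ i \<le> (INF y\<in>P. y $ i) + \<delta>" if "y \<in> P" for y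
  proof -
    have "y $ i - \<delta> \<le> (INF y\<in>P. y $ i)"
      by (rule cINF_greatest[OF ne]) (use osc[OF that] in \<open>fastforce simp: abs_le_iff\<close>)
    then show ?thesis by simp
  qed
  then have "(SUP y\<in>P. y $ i) \<le> (INF y\<in>P. y $ i) + \<delta>" by (rule cSUP_least[OF ne])
  then have "\<bar>real_of_int \<gamma> - real_of_int \<gamma>'\<bar> < 1"
    using assms(2-4) by (auto simp: branch_values_def)
  then show ?thesis by linarith
qed

lemma solved_at_rootnodeI:
  assumes osc: "\<And>i y y'. \<lbrakk>i < r; y \<in> P; y' \<in> P; \<And>j. i < j \<Longrightarrow> j < r \<Longrightarrow> y $ j = y' $ j\<rbrakk>
      \<Longrightarrow> \<bar>y $ i - y' $ i\<bar> \<le> \<delta> i"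
    and \<delta>: "\<And>i. i < r \<Longrightarrow> \<delta> i < 1"
  shows "solved_at_rootnode r P"
proof -
  \<comment> \<open>Two facts are carried through the levels together: there is at most one node,
    and the points of a node agree in the last \<open>k\<close> coordinates, those already branched
    on. The agreement makes \<open>osc\<close> applicable to the next variable.\<close>
  have inv: "(\<forall>a\<in>bb_level r P k. \<forall>b\<in>bb_level r P k. a = b) \<and>
      (\<forall>(\<gamma>s, P')\<in>bb_level r P k. P' \<subseteq> P \<and>
        (\<forall>y\<in>P'. \<forall>y'\<in>P'. \<forall>j. r - k \<le> j \<and> j < r \<longrightarrow> y $ j = y' $ j))" if "k \<le> r" for k
    using that
  proof (induction k)
    case (Suc k)
    have k: "k \<le> r" using Suc.prems by simp
    note IH = Suc.IH[OF k, THEN conjunct1, rule_format]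
    have inv: "P' \<subseteq> P \<and> (\<forall>y\<in>P'. \<forall>y'\<in>P'. \<forall>j. r - k \<le> j \<and> j < r \<longrightarrow> y $ j = y' $ j)"
      if "(\<gamma>s, P') \<in> bb_level r P k" for \<gamma>s P'
      using bspec[OF Suc.IH[OF k, THEN conjunct2] that] unfolding prod.case .
    note sub = inv[THEN conjunct1] and agree = inv[THEN conjunct2, rule_format]
    let ?i = "r - Suc k"
    have uniq: "\<gamma> = \<gamma>'"
      if "(\<gamma>s, P') \<in> bb_level r P k" "\<gamma> \<in> branch_values ?i P'" "\<gamma>' \<in> branch_values ?i P'"
      for \<gamma> \<gamma>' \<gamma>s P'
    proof (rule branch_values_unique[OF _ \<delta>[of ?i] that(2,3)])
      fix y y' assume "y \<in> P'" "y' \<in> P'"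
      then show "\<bar>y $ ?i - y' $ ?i\<bar> \<le> \<delta> ?i"
        using sub[OF that(1)] Suc.prems by (intro osc agree[OF that(1)]) auto
    qed (use Suc.prems in simp)
    have "a = b" if "a \<in> bb_level r P (Suc k)" "b \<in> bb_level r P (Suc k)" for a b
    proof -
      from that obtain \<gamma> \<gamma>s P' \<gamma>' \<gamma>s' P'' where
        a: "a = (\<gamma> # \<gamma>s, P' \<inter> {y. y $ ?i = real_of_int \<gamma>})"
          "(\<gamma>s, P') \<in> bb_level r P k" "\<gamma> \<in> branch_values ?i P'" and
        b: "b = (\<gamma>' # \<gamma>s', P'' \<inter> {y. y $ ?i = real_of_int \<gamma>'})"
          "(\<gamma>s', P'') \<in> bb_level r P k" "\<gamma>' \<in> branch_values ?i P''" by auto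
      have "(\<gamma>s, P') = (\<gamma>s', P'')" using IH a(2) b(2) by blast
      then show ?thesis using a b uniq by auto
    qed
    moreover have "Q \<subseteq> P \<and> (\<forall>y\<in>Q. \<forall>y'\<in>Q. \<forall>j. ?i \<le> j \<and> j < r \<longrightarrow> y $ j = y' $ j)"
      if "(\<gamma>s', Q) \<in> bb_level r P (Suc k)" for \<gamma>s' Q
    proof -
      from that obtain \<gamma> \<gamma>s P' where Q: "Q = P' \<inter> {y. y $ ?i = real_of_int \<gamma>}"
        and P': "(\<gamma>s, P') \<in> bb_level r P k" by auto
      have "y $ j = y' $ j" if "y \<in> Q" "y' \<in> Q" "?i \<le> j" "j < r" for y y' j
      proof (cases "j = ?i")
        case False
        then have "r - k \<le> j" using that by simp
        then show ?thesis using agree[OF P', of y y' j] that Q by blast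
      qed (use that Q in simp)
      then show ?thesis using sub[OF P'] Q by blast
    qed
    ultimately show ?case
      by (intro conjI ballI, blast, simp only: split_paired_all prod.case, blast)
  qed simp
  have single: "finite S \<and> card S \<le> 1" if "\<forall>a\<in>S. \<forall>b\<in>S. a = b" for S :: "(int list \<times> real vec set) set"
  proof (cases "S = {}")
    case False
    then obtain a where "a \<in> S" by blast
    then have "S = {a}" using that by blast
    then show ?thesis by simp
  qed simp
  show ?thesis
    unfolding solved_at_rootnode_def
  proof
    fix k assume "k \<in> {1..r}"
    then have "k \<le> r" by simp
    then show "finite (bb_level r P k) \<and> card (bb_level r P k) \<le> 1"
      by (rule single[OF inv[THEN conjunct1]])
  qed
qed

text \<open>The images of two points lie in the box from \<open>l\<close> to \<open>w\<close>, so
  their difference is no longer than its diagonal. By \<open>LLL_col_0_bound\<close> a long first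
  column makes every Gram-Schmidt vector longer than this diagonal, and
  \<open>coordinate_bound\<close> then keeps the width below 1.\<close>

lemma LLL_solved_at_rootnode:
  fixes l w :: "real vec"
  assumes B: "B \<in> carrier_mat N r" and li: "lin_indep_vecs N (cols B)" and LLL: "LLL_reduced B"
    and l: "l \<in> carrier_vec N" and w: "w \<in> carrier_vec N"
    and short: "2 ^ (r - 1) * ((w - l) \<bullet> (w - l)) < col B 0 \<bullet> col B 0"
  shows "solved_at_rootnode r {y \<in> carrier_vec r. l \<le> B *\<^sub>v y \<and> B *\<^sub>v y \<le> w}"
proof -
  let ?S = "(w - l) \<bullet> (w - l)"
  have S0: "0 \<le> ?S" by (simp add: scalar_prod_def sum_nonneg)
  have G: "?S < gs B i \<bullet> gs B i" if "i < r" for i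
  proof -
    \<comment> \<open>As \<open>i \<le> r - 1\<close>, the factor for the last index serves all
      indices.\<close>
    have "2 ^ i * ?S \<le> 2 ^ (r - 1) * ?S" using S0 that by (intro mult_right_mono power_increasing) auto
    also have "\<dots> < 2 ^ i * (gs B i \<bullet> gs B i)" using short LLL_col_0_bound[OF B li LLL that] by simp
    finally show ?thesis by simp
  qed
  show ?thesis
  proof (rule solved_at_rootnodeI)
    fix i y y' assume i: "i < r" and y: "y \<in> {y \<in> carrier_vec r. l \<le> B *\<^sub>v y \<and> B *\<^sub>v y \<le> w}"
      and y': "y' \<in> {y \<in> carrier_vec r. l \<le> B *\<^sub>v y \<and> B *\<^sub>v y \<le> w}"
      and eq: "\<And>j. i < j \<Longrightarrow> j < r \<Longrightarrow> y $ j = y' $ j"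
    let ?G = "gs B i \<bullet> gs B i"
    have c: "y \<in> carrier_vec r" "y' \<in> carrier_vec r" using y y' by auto
    have "(y $ i - y' $ i)\<^sup>2 * ?G \<le> (B *\<^sub>v (y - y')) \<bullet> (B *\<^sub>v (y - y'))"
      using coordinate_bound[OF B li _ i, of "y - y'"] c i eq by simp
    also have "\<dots> \<le> ?S"
    proof -
      have dif: "B *\<^sub>v (y - y') = B *\<^sub>v y - B *\<^sub>v y'" using B c by (simp add: mult_minus_distrib_mat_vec)
      have "((B *\<^sub>v y) $ j - (B *\<^sub>v y') $ j)\<^sup>2 \<le> (w $ j - l $ j)\<^sup>2" if "j < N" for j
      proof (rule power2_le_iff_abs_le[THEN iffD2])
        have "l $ j \<le> (B *\<^sub>v y) $ j" "(B *\<^sub>v y) $ j \<le> w $ j" "l $ j \<le> (B *\<^sub>v y') $ j" "(B *\<^sub>v y') $ j \<le> w $ j"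
          using y y' that B l w unfolding less_eq_vec_def by auto
        then show "0 \<le> w $ j - l $ j" "\<bar>(B *\<^sub>v y) $ j - (B *\<^sub>v y') $ j\<bar> \<le> w $ j - l $ j" by auto
      qed
      then show ?thesis
        unfolding dif using B l w c
        by (auto simp: scalar_prod_def power2_eq_square intro!: sum_mono simp del: index_mult_mat_vec)
    qed
    finally have "(y $ i - y' $ i)\<^sup>2 \<le> ?S / ?G" using G[OF i] S0 by (simp add: field_simps)
    then show "\<bar>y $ i - y' $ i\<bar> \<le> sqrt (?S / ?G)" using real_le_rsqrt[of "\<bar>y $ i - y' $ i\<bar>"] by simp
  next
    fix i assume "i < r"
    then show "sqrt ((w - l) \<bullet> (w - l) / (gs B i \<bullet> gs B i)) < 1" using G[of i] S0 by simp
  qed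
qed

section \<open>Counting matrices and short integer vectors\<close>

lemma G_mats_bij_betw:
  "bij_betw (\<lambda>f. mat m n f) (({..<m} \<times> {..<n}) \<rightarrow>\<^sub>E {1..int M}) (G_mats m n M)"
proof (rule bij_betw_byWitness[where f' = "\<lambda>A. restrict (\<lambda>p. A $$ p) ({..<m} \<times> {..<n})"])
  show "\<forall>f\<in>({..<m} \<times> {..<n}) \<rightarrow>\<^sub>E {1..int M}.
      restrict (\<lambda>p. mat m n f $$ p) ({..<m} \<times> {..<n}) = f"
    by (auto simp: restrict_def PiE_def extensional_def fun_eq_iff)
  show "\<forall>A\<in>G_mats m n M. mat m n (restrict (\<lambda>p. A $$ p) ({..<m} \<times> {..<n})) = A"
    by (auto simp: G_mats_def intro!: eq_matI)
  show "mat m n ` (({..<m} \<times> {..<n}) \<rightarrow>\<^sub>E {1..int M}) \<subseteq> G_mats m n M"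
    by (fastforce simp: G_mats_def PiE_iff)
  show "(\<lambda>A. restrict (\<lambda>p. A $$ p) ({..<m} \<times> {..<n})) ` G_mats m n M
      \<subseteq> ({..<m} \<times> {..<n}) \<rightarrow>\<^sub>E {1..int M}"
    by (rule image_subsetI, rule restrict_PiE_iff[THEN iffD2]) (auto simp: G_mats_def)
qed

lemma finite_G_mats: "finite (G_mats m n M)"
  using bij_betw_finite[OF G_mats_bij_betw[of m n M]] by (simp add: finite_PiE)

lemma card_G_mats: "card (G_mats m n M) = M ^ (m * n)"
  using bij_betw_same_card[OF G_mats_bij_betw[of m n M]] by (simp add: card_PiE)

text \<open>Where \<open>x $ j0 \<noteq> 0\<close>, column \<open>j0\<close> of \<open>A\<close> is determined by the other columns and \<open>A *\<^sub>v x\<close>.\<close>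

lemma card_G_mats_fiber:
  assumes x: "x \<in> carrier_vec n" "x \<noteq> 0\<^sub>v n"
  shows "card {A \<in> G_mats m n M. A *\<^sub>v x = y} \<le> M ^ (m * (n - 1))"
proof -
  obtain j0 where j0: "j0 < n" "x $ j0 \<noteq> 0" using x by (metis eq_vecI carrier_vecD index_zero_vec)
  let ?I = "{..<m} \<times> ({..<n} - {j0})"
  let ?F = "\<lambda>A. restrict (\<lambda>p. A $$ p) ?I"
  have "inj_on ?F {A \<in> G_mats m n M. A *\<^sub>v x = y}"
  proof (rule inj_onI)
    fix A B assume A: "A \<in> {A \<in> G_mats m n M. A *\<^sub>v x = y}"
      and B: "B \<in> {A \<in> G_mats m n M. A *\<^sub>v x = y}" and eq: "?F A = ?F B"
    have c: "A \<in> carrier_mat m n" "B \<in> carrier_mat m n" using A B by (auto simp: G_mats_def)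
    have eq': "A $$ (i, j) = B $$ (i, j)" if "i < m" "j < n" "j \<noteq> j0" for i j
      using fun_cong[OF eq, of "(i, j)"] that by simp
    have row: "(C *\<^sub>v x) $ i = C $$ (i, j0) * x $ j0 + (\<Sum>j\<in>{..<n} - {j0}. C $$ (i, j) * x $ j)"
      if "C \<in> carrier_mat m n" "i < m" for C i
      using that x j0 by (simp add: scalar_prod_def atLeast0LessThan sum.remove[of "{..<n}" j0])
    have "A $$ (i, j0) = B $$ (i, j0)" if i: "i < m" for i
    proof -
      have "(A *\<^sub>v x) $ i = (B *\<^sub>v x) $ i" using A B by simp
      moreover have "(\<Sum>j\<in>{..<n} - {j0}. A $$ (i, j) * x $ j) = (\<Sum>j\<in>{..<n} - {j0}. B $$ (i, j) * x $ j)"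
        using eq' i by (intro sum.cong) auto
      ultimately show ?thesis using row[OF c(1) i] row[OF c(2) i] j0 by simp
    qed
    then have "A $$ (i, j) = B $$ (i, j)" if "i < m" "j < n" for i j
      using eq' that by (cases "j = j0") auto
    then show "A = B" using c by (intro eq_matI) auto
  qed
  moreover have "?F ` {A \<in> G_mats m n M. A *\<^sub>v x = y} \<subseteq> ?I \<rightarrow>\<^sub>E {1..int M}"
    by (rule image_subsetI, rule restrict_PiE_iff[THEN iffD2]) (auto simp: G_mats_def)
  ultimately have "card {A \<in> G_mats m n M. A *\<^sub>v x = y} \<le> card (?I \<rightarrow>\<^sub>E {1..int M})"
    by (intro card_inj_on_le) (auto intro: finite_PiE)
  also have "\<dots> = M ^ (m * (n - 1))" using j0 by (simp add: card_PiE)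
  finally show ?thesis .
qed

text \<open>A cube in place of the ball of radius \<open>K\<close>: it contains the integer points
  of the ball, and its own are counted coordinate by coordinate.\<close>

definition int_box :: "nat \<Rightarrow> real \<Rightarrow> int vec set" where
  "int_box n K = {x \<in> carrier_vec n. \<forall>i<n. \<bar>real_of_int (x $ i)\<bar> \<le> K}"

lemma int_box_bound:
  assumes "0 \<le> K"
  shows "finite (int_box n K) \<and> real (card (int_box n K)) \<le> (2 * K + 1) ^ n"
proof -
  \<comment> \<open>Integers of absolute value at most \<open>K\<close> lie in this range, which has
    \<open>2 * \<lfloor>K\<rfloor> + 1\<close> elements.\<close>
  let ?R = "{- \<lfloor>K\<rfloor>..\<lfloor>K\<rfloor>}"
  let ?F = "\<lambda>x. restrict (\<lambda>i. x $ i) {..<n}"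
  have inj: "inj_on ?F (int_box n K)"
  proof (rule inj_onI)
    fix x y assume "x \<in> int_box n K" "y \<in> int_box n K" and eq: "?F x = ?F y"
    moreover have "x $ i = y $ i" if "i < n" for i using fun_cong[OF eq, of i] that by simp
    ultimately show "x = y" by (intro eq_vecI) (auto simp: int_box_def)
  qed
  have sub: "?F ` int_box n K \<subseteq> {..<n} \<rightarrow>\<^sub>E ?R"
  proof (rule image_subsetI, rule restrict_PiE_iff[THEN iffD2], rule ballI)
    fix x i assume "x \<in> int_box n K" "i \<in> {..<n}"
    then have "\<bar>real_of_int (x $ i)\<bar> \<le> K" by (auto simp: int_box_def)
    then have "x $ i \<le> \<lfloor>K\<rfloor>" "- (x $ i) \<le> \<lfloor>K\<rfloor>" by (auto simp: le_floor_iff)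
    then show "x $ i \<in> ?R" by auto
  qed
  have fin: "finite ({..<n} \<rightarrow>\<^sub>E ?R)" by (simp add: finite_PiE)
  have "real (card (int_box n K)) \<le> real (card ({..<n} \<rightarrow>\<^sub>E ?R))"
    using card_inj_on_le[OF inj sub fin] by simp
  also have "\<dots> = (2 * real_of_int \<lfloor>K\<rfloor> + 1) ^ n" using assms by (simp add: card_PiE)
  also have "\<dots> \<le> (2 * K + 1) ^ n" using assms by (intro power_mono) auto
  finally show ?thesis using inj_on_finite[OF inj sub fin] by simp
qed

lemma int_boxI:
  assumes "x \<in> carrier_vec n" "0 \<le> K"
    and "map_vec real_of_int x \<bullet> map_vec real_of_int x \<le> K\<^sup>2"
  shows "x \<in> int_box n K"
proof -
  have "\<bar>real_of_int (x $ i)\<bar> \<le> K" if "i < n" for i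
  proof -
    have "(real_of_int (x $ i))\<^sup>2 \<le> (\<Sum>i\<in>{0..<n}. (real_of_int (x $ i))\<^sup>2)"
      using that by (intro member_le_sum) auto
    also have "\<dots> \<le> K\<^sup>2" using assms by (simp add: scalar_prod_def power2_eq_square)
    finally show ?thesis using assms(2) by (metis abs_le_square_iff abs_of_nonneg)
  qed
  then show ?thesis using assms(1) by (simp add: int_box_def)
qed

text \<open>Union bound over the pairs in \<open>X \<times> Y\<close>, with
  \<open>card_G_mats_fiber\<close> applied to each pair.\<close>

lemma card_short_solutions:
  assumes X: "finite X" "X \<subseteq> carrier_vec n - {0\<^sub>v n}" and Y: "finite Y"
    and S: "S \<subseteq> G_mats m n M" "\<And>A. A \<in> S \<Longrightarrow> \<exists>x\<in>X. A *\<^sub>v x \<in> Y"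
  shows "card S \<le> card X * card Y * M ^ (m * (n - 1))"
proof -
  let ?T = "\<lambda>(x, y). {A \<in> G_mats m n M. A *\<^sub>v x = y}"
  have "S \<subseteq> (\<Union>p\<in>X \<times> Y. ?T p)" using S by fastforce
  then have "card S \<le> card (\<Union>p\<in>X \<times> Y. ?T p)"
    using X Y finite_G_mats[of m n M] by (intro card_mono) auto
  also have "\<dots> \<le> (\<Sum>p\<in>X \<times> Y. card (?T p))" using X Y by (intro card_UN_le) auto
  also have "\<dots> \<le> (\<Sum>p\<in>X \<times> Y. M ^ (m * (n - 1)))"
    using X(2) by (intro sum_mono) (auto simp del: One_nat_def intro!: card_G_mats_fiber)
  finally show ?thesis by (simp add: card_cartesian_product)
qed

text \<open>Here \<open>p\<close> stands for the number of integer coordinates to be counted. For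
  \<open>K \<ge> sqrt 5\<close> the number \<open>4 * sqrt 2 * K\<close> exceeds
  \<open>4 * K + 2\<close> by a factor of at least 1.15, and 1.15^5 > 2 pays for the leading
  2.\<close>

lemma threshold_power_bound:
  assumes p: "5 \<le> p" and K: "sqrt 5 \<le> K" and m: "1 \<le> m"
    and M: "real M > (2 powr (5 / 2) * K) powr (real p / real m)"
  shows "2 * (2 * (2 * K + 1)) ^ p \<le> real M ^ m"
proof -
  have s5: "2.236 \<le> sqrt 5" and s2: "1.414 \<le> sqrt 2" by (rule real_le_rsqrt, simp add: power2_eq_square)+
  have K': "2.236 \<le> K" using s5 K by linarith
  have "2 powr (5 / 2 :: real) = 2 powr (2 + 1 / 2)" by simp
  also have "\<dots> = 4 * sqrt 2" unfolding powr_add by (simp add: powr_half_sqrt)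
  finally have E: "2 powr (5 / 2 :: real) = 4 * sqrt 2" .
  have "(1.15 * (2 * (2 * K + 1))) \<le> 4 * 1.414 * K" using K' by simp
  also have "\<dots> \<le> 2 powr (5 / 2) * K" unfolding E using s2 K' by (intro mult_right_mono) auto
  finally have le: "1.15 * (2 * (2 * K + 1)) \<le> 2 powr (5 / 2) * K" .
  have "(2::real) \<le> 1.15 ^ 5" by (simp add: eval_nat_numeral)
  also have "\<dots> \<le> 1.15 ^ p" using p by (intro power_increasing) auto
  finally have "2 * (2 * (2 * K + 1)) ^ p \<le> 1.15 ^ p * (2 * (2 * K + 1)) ^ p"
    using K' by (intro mult_right_mono) auto
  also have "\<dots> = (1.15 * (2 * (2 * K + 1))) ^ p" by (simp only: power_mult_distrib)
  also have "\<dots> \<le> (2 powr (5 / 2) * K) ^ p" using le K' by (intro power_mono) auto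
  \<comment> \<open>The exponents \<open>p / m\<close> and \<open>m\<close> multiply to
    \<open>p\<close>, which brings in the threshold for \<open>M\<close>.\<close>
  also have "\<dots> = ((2 powr (5 / 2) * K) powr (real p / real m)) ^ m"
    using m K' by (simp add: powr_powr flip: powr_realpow)
  also have "\<dots> \<le> real M ^ m" using M by (intro power_mono) auto
  finally show ?thesis .
qed

section \<open>From an unsolved problem to a short integer vector\<close>

text \<open>Contrapositive of \<open>LLL_solved_at_rootnode\<close>. With \<open>r = 0\<close> there
  are no levels and the problem counts as solved, so an unsolved one does have a first
  column.\<close>

lemma LLL_solved_or_short:
  fixes l w :: "real vec"
  assumes "B \<in> carrier_mat N r" "lin_indep_vecs N (cols B)" "LLL_reduced B"
    and "l \<in> carrier_vec N" "w \<in> carrier_vec N"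
    and "\<not> solved_at_rootnode r {y \<in> carrier_vec r. l \<le> B *\<^sub>v y \<and> B *\<^sub>v y \<le> w}"
  shows "0 < r \<and> col B 0 \<bullet> col B 0 \<le> 2 ^ (r - 1) * ((w - l) \<bullet> (w - l))"
proof
  show "0 < r" using assms(6) by (cases r) (auto simp: solved_at_rootnode_def)
  show "col B 0 \<bullet> col B 0 \<le> 2 ^ (r - 1) * ((w - l) \<bullet> (w - l))"
    using LLL_solved_at_rootnode[OF assms(1-5)] assms(6) by force
qed

text \<open>The first basis vector stacks A u on top of u, where u is the first column of
  \<open>U\<close>; its squared length is the sum of the two squared lengths.\<close>

lemma rangespace_unsolved_imp_short:
  assumes A: "A \<in> carrier_mat m n"
    and l: "l1 \<in> carrier_vec m" "l2 \<in> carrier_vec n" and w: "w1 \<in> carrier_vec m" "w2 \<in> carrier_vec n"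
    and uns: "\<not> rangespace_solved_at_rootnode l1 w1 l2 w2 A"
  defines "d \<equiv> map_vec real_of_int ((w1 @\<^sub>v w2) - (l1 @\<^sub>v l2))"
  shows "\<exists>u \<in> carrier_vec n. u \<noteq> 0\<^sub>v n \<and>
    map_vec real_of_int u \<bullet> map_vec real_of_int u +
    map_vec real_of_int (A *\<^sub>v u) \<bullet> map_vec real_of_int (A *\<^sub>v u) \<le> 2 ^ (n - 1) * (d \<bullet> d)"
proof -
  have dc: "dim_col A = n" using A by simp
  from uns obtain U where U: "rangespace_admissible A U"
    and ns: "\<not> solved_at_rootnode n (rangespace_polyhedron A l1 w1 l2 w2 U)"
    unfolding rangespace_solved_at_rootnode_def dc by blast
  let ?B = "map_mat real_of_int (stack_id A * U)"
  have S: "stack_id A \<in> carrier_mat (m + n) n" using A unfolding stack_id_def by auto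
  have Uc: "U \<in> carrier_mat n n" using U dc by (simp add: rangespace_admissible_def unimodular_def)
  have B: "?B \<in> carrier_mat (m + n) n" using S Uc by simp
  have li: "lin_indep_vecs (m + n) (cols ?B)" and LLL: "LLL_reduced ?B"
    using U S unfolding rangespace_admissible_def lattice_basis_def by auto
  have lw: "map_vec real_of_int (l1 @\<^sub>v l2) \<in> carrier_vec (m + n)"
    "map_vec real_of_int (w1 @\<^sub>v w2) \<in> carrier_vec (m + n)" using l w by auto
  have d: "map_vec real_of_int (w1 @\<^sub>v w2) - map_vec real_of_int (l1 @\<^sub>v l2) = d"
    unfolding d_def using l w by (intro eq_vecI) auto
  have n: "0 < n" and short: "col ?B 0 \<bullet> col ?B 0 \<le> 2 ^ (n - 1) * (d \<bullet> d)"
    using LLL_solved_or_short[OF B li LLL lw] ns unfolding rangespace_polyhedron_def dc d by auto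
  let ?u = "col U 0"
  have u: "?u \<in> carrier_vec n" using Uc by auto
  have "col (stack_id A * U) 0 = stack_id A *\<^sub>v ?u" using col_mult2[OF S Uc n] .
  also have "\<dots> = (A *\<^sub>v ?u) @\<^sub>v ?u"
    unfolding stack_id_def dc using mat_mult_append[OF A one_carrier_mat u] u by simp
  finally have col: "col ?B 0 = map_vec real_of_int (A *\<^sub>v ?u) @\<^sub>v map_vec real_of_int ?u"
    using S Uc n A u by (auto intro!: eq_vecI)
  \<comment> \<open>Otherwise the first basis vector would vanish, contrary to linear
    independence.\<close>
  have "?u \<noteq> 0\<^sub>v n"
  proof
    assume "?u = 0\<^sub>v n"
    then have "col ?B 0 = 0\<^sub>v (m + n)" unfolding col using A by (auto intro!: eq_vecI)
    then show False using col_nonzero[OF B li n] by simp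
  qed
  moreover have "col ?B 0 \<bullet> col ?B 0 = map_vec real_of_int ?u \<bullet> map_vec real_of_int ?u +
    map_vec real_of_int (A *\<^sub>v ?u) \<bullet> map_vec real_of_int (A *\<^sub>v ?u)"
    unfolding col using A u by (subst scalar_prod_append[of _ m _ n]) auto
  ultimately show ?thesis using u short by auto
qed

text \<open>The first column of \<open>B\<close> belongs to the lattice generated by
  \<open>B\<close>, being the image of a unit vector. As this lattice is the integer kernel of
  \<open>A\<close>, the column is itself the required integer vector.\<close>

lemma nullspace_unsolved_imp_short:
  assumes A: "A \<in> carrier_mat m n"
    and l: "l2 \<in> carrier_vec n" and w: "w2 \<in> carrier_vec n"
    and uns: "\<not> nullspace_solved_at_rootnode l1 l2 w2 A"
  defines "d \<equiv> map_vec real_of_int (w2 - l2)"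
  shows "m < n \<and> (\<exists>x \<in> carrier_vec n. x \<noteq> 0\<^sub>v n \<and> A *\<^sub>v x = 0\<^sub>v m \<and>
    map_vec real_of_int x \<bullet> map_vec real_of_int x \<le> 2 ^ (n - m - 1) * (d \<bullet> d))"
proof -
  have dim: "dim_col A = n" "dim_row A = m" using A by auto
  from uns obtain B x0 where adm: "nullspace_admissible A l1 B x0"
    and ns: "\<not> solved_at_rootnode (n - m) (nullspace_polyhedron l2 w2 B x0)"
    unfolding nullspace_solved_at_rootnode_def dim by blast
  have B: "B \<in> carrier_mat n (n - m)" and x0: "x0 \<in> carrier_vec n" and LLL: "LLL_reduced B"
    and lat: "lattice_of B = integer_kernel A" and li: "lin_indep_vecs n (cols B)"
    using adm dim by (auto simp: nullspace_admissible_def lattice_basis_def)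
  have lw: "map_vec real_of_int (l2 - x0) \<in> carrier_vec n" "map_vec real_of_int (w2 - x0) \<in> carrier_vec n"
    using l w x0 by auto
  have d: "map_vec real_of_int (w2 - x0) - map_vec real_of_int (l2 - x0) = d"
    unfolding d_def using l w x0 by (intro eq_vecI) auto
  have r: "0 < n - m" and short: "col B 0 \<bullet> col B 0 \<le> 2 ^ (n - m - 1) * (d \<bullet> d)"
    using LLL_solved_or_short[OF B li LLL lw] ns B unfolding nullspace_polyhedron_def d by auto
  have "col B 0 = B *\<^sub>v map_vec real_of_int (unit_vec (n - m) 0)"
  proof -
    have "map_vec real_of_int (unit_vec (n - m) 0) = unit_vec (n - m) 0" by (intro eq_vecI) (auto simp: unit_vec_def)
    then show ?thesis using B r by (intro eq_vecI) auto
  qed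
  then have "col B 0 \<in> integer_kernel A" unfolding lat[symmetric] lattice_of_def using B by auto
  then obtain x where x: "x \<in> carrier_vec n" "A *\<^sub>v x = 0\<^sub>v m" and col: "col B 0 = map_vec real_of_int x"
    unfolding integer_kernel_def dim by auto
  have "x \<noteq> 0\<^sub>v n" using col_nonzero[OF B li r] col by (auto simp: vec_eq_iff)
  then show ?thesis using x short r unfolding col by auto
qed

section \<open>The radius of the short vectors and the thresholds\<close>

text \<open>By integrality each gap is at least 1. With \<open>n \<ge> 5\<close> this gives the
  lower bound \<open>sqrt 5\<close> on which the constants of \<open>threshold_power_bound\<close>
  rest.\<close>

lemma gap_sq_norm_ge:
  fixes l w :: "int vec"
  assumes "l \<in> carrier_vec n" "w \<in> carrier_vec n" "\<forall>j<n. l $ j < w $ j"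
  shows "real n \<le> map_vec real_of_int (w - l) \<bullet> map_vec real_of_int (w - l)"
proof -
  have "real n = (\<Sum>j\<in>{0..<n}. 1)" by simp
  also have "\<dots> \<le> (\<Sum>j\<in>{0..<n}. real_of_int ((w $ j - l $ j) * (w $ j - l $ j)))"
  proof (rule sum_mono)
    fix j assume "j \<in> {0..<n}"
    then have "1 \<le> w $ j - l $ j" using assms by auto
    then have "1 \<le> (w $ j - l $ j) * (w $ j - l $ j)" using mult_mono[of 1 "w $ j - l $ j" 1] by simp
    then show "1 \<le> real_of_int ((w $ j - l $ j) * (w $ j - l $ j))" by linarith
  qed
  finally show ?thesis using assms by (simp add: scalar_prod_def)
qed

text \<open>The factor \<open>sqrt (2 ^ (r - 1))\<close> bounds the ratio between the first and the last Gram-Schmidt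
  vector of an LLL-reduced basis of rank \<open>r\<close>.\<close>

definition radius :: "nat \<Rightarrow> real vec \<Rightarrow> real" where
  "radius r d = sqrt (2 ^ (r - 1)) * vnorm d"

lemma radius_sq: "(radius r d)\<^sup>2 = 2 ^ (r - 1) * (d \<bullet> d)"
  by (simp add: radius_def power_mult_distrib vnorm_sq)

lemma radius_ge:
  assumes "5 \<le> d \<bullet> d"
  shows "sqrt 5 \<le> radius r d"
proof (rule real_le_lsqrt[THEN order_trans])
  show "5 \<le> (radius r d)\<^sup>2"
    unfolding radius_sq using assms mult_mono[of 1 "2 ^ (r - 1)" 5 "d \<bullet> d"] by simp
qed (auto simp: radius_def vnorm_def scalar_prod_def sum_nonneg)

text \<open>Splits the exponent \<open>(r + 4) / 2\<close> of the thresholds into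
  \<open>(r - 1) / 2\<close>, the loss from LLL reduction contained in \<open>radius\<close>, and
  \<open>5 / 2\<close>, the constant of \<open>threshold_power_bound\<close>.\<close>

lemma powr_radius:
  assumes "1 \<le> r"
  shows "2 powr (5 / 2) * radius r d = 2 powr ((real r + 4) / 2) * vnorm d"
proof -
  have "sqrt (2 ^ (r - 1)) = 2 powr ((real r - 1) / 2)"
    using assms by (simp add: powr_half_sqrt[symmetric] powr_powr of_nat_diff flip: powr_realpow)
  then have "2 powr (5 / 2) * sqrt (2 ^ (r - 1)) = 2 powr (5 / 2 + (real r - 1) / 2)"
    unfolding powr_add by simp
  also have "5 / 2 + (real r - 1) / 2 = (real r + 4) / 2" by (simp add: field_simps)
  finally show ?thesis unfolding radius_def by simp
qed

section \<open>Bounding the fraction of bad matrices\<close>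

text \<open>A bad \<open>A\<close> sends a nonzero u in the \<open>n\<close>-dimensional box to a
  vector in the \<open>m\<close>-dimensional box, both of radius \<open>K\<close>. There are at most
  \<open>(2 * K + 1) ^ (n + m)\<close> such pairs, each met by at most
  \<open>M ^ (m * (n - 1))\<close> matrices.\<close>

lemma rangespace_almost_all:
  assumes m: "m \<ge> 1" and n: "n \<ge> 5"
    and l: "l1 \<in> carrier_vec m" "l2 \<in> carrier_vec n" and w: "w1 \<in> carrier_vec m" "w2 \<in> carrier_vec n"
    and gap: "\<forall>j<n. l2 $ j < w2 $ j"
    and M: "real M > (2 powr ((real n + 4) / 2)
      * vnorm (map_vec real_of_int ((w1 @\<^sub>v w2) - (l1 @\<^sub>v l2)))) powr (real n / real m + 1)"
  shows "almost_all n (G_mats m n M) (rangespace_solved_at_rootnode l1 w1 l2 w2)"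
proof -
  define d where "d = map_vec real_of_int ((w1 @\<^sub>v w2) - (l1 @\<^sub>v l2))"
  define K where "K = radius n d"
  have "d = map_vec real_of_int (w1 - l1) @\<^sub>v map_vec real_of_int (w2 - l2)"
    unfolding d_def using l w by (intro eq_vecI) auto
  then have "d \<bullet> d = map_vec real_of_int (w1 - l1) \<bullet> map_vec real_of_int (w1 - l1) +
      map_vec real_of_int (w2 - l2) \<bullet> map_vec real_of_int (w2 - l2)"
    using l w by (simp add: scalar_prod_append[of _ m _ n])
  moreover have "0 \<le> map_vec real_of_int (w1 - l1) \<bullet> map_vec real_of_int (w1 - l1)"
    by (simp add: scalar_prod_def sum_nonneg)
  ultimately have "5 \<le> d \<bullet> d" using gap_sq_norm_ge[OF l(2) w(2) gap] n by linarith
  then have K5: "sqrt 5 \<le> K" unfolding K_def by (rule radius_ge)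
  then have K0: "0 \<le> K" using real_sqrt_ge_zero[of 5] by linarith
  \<comment> \<open>The exponent of the threshold counts the \<open>n + m\<close> coordinates of u
    and A u together.\<close>
  have "real n / real m + 1 = real (n + m) / real m" using m by (simp add: field_simps)
  then have thr: "2 * (2 * (2 * K + 1)) ^ (n + m) \<le> real M ^ m"
    using M n K5 m powr_radius[of n d] unfolding d_def[symmetric] K_def
    by (intro threshold_power_bound) auto
  let ?bad = "{A \<in> G_mats m n M. \<not> rangespace_solved_at_rootnode l1 w1 l2 w2 A}"
  let ?X = "int_box n K - {0\<^sub>v n}" and ?Y = "int_box m K"
  have "card ?bad \<le> card ?X * card ?Y * M ^ (m * (n - 1))"
  proof (rule card_short_solutions)
    fix A assume "A \<in> ?bad"
    then have A: "A \<in> carrier_mat m n" and "\<not> rangespace_solved_at_rootnode l1 w1 l2 w2 A"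
      by (auto simp: G_mats_def)
    then obtain u where u: "u \<in> carrier_vec n" "u \<noteq> 0\<^sub>v n" and
      "map_vec real_of_int u \<bullet> map_vec real_of_int u +
      map_vec real_of_int (A *\<^sub>v u) \<bullet> map_vec real_of_int (A *\<^sub>v u) \<le> K\<^sup>2"
      using rangespace_unsolved_imp_short[OF A l w] unfolding K_def radius_sq d_def by blast
    moreover have "0 \<le> map_vec real_of_int u \<bullet> map_vec real_of_int u"
      "0 \<le> map_vec real_of_int (A *\<^sub>v u) \<bullet> map_vec real_of_int (A *\<^sub>v u)"
      by (simp_all add: scalar_prod_def sum_nonneg)
    ultimately have "u \<in> int_box n K" "A *\<^sub>v u \<in> int_box m K"
      using A K0 by (auto intro!: int_boxI)
    then show "\<exists>x\<in>?X. A *\<^sub>v x \<in> ?Y" using u by auto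
  qed (use int_box_bound[OF K0] in \<open>auto simp: int_box_def\<close>)
  also have "\<dots> \<le> card (int_box n K) * card ?Y * M ^ (m * (n - 1))"
    using int_box_bound[OF K0] by (intro mult_right_mono card_mono) auto
  finally have "real (card ?bad) \<le> real (card (int_box n K) * card ?Y * M ^ (m * (n - 1)))"
    by (simp only: of_nat_le_iff)
  also have "\<dots> \<le> (2 * K + 1) ^ n * (2 * K + 1) ^ m * real M ^ (m * (n - 1))"
    using int_box_bound[OF K0] K0 by (auto intro!: mult_mono)
  finally have "2 ^ n * real (card ?bad) \<le> 2 ^ n * (2 * K + 1) ^ (n + m) * real M ^ (m * (n - 1))"
    by (simp add: power_add)
  also have "\<dots> \<le> real M ^ m * real M ^ (m * (n - 1))"
  proof (rule mult_right_mono)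
    \<comment> \<open>The factor \<open>2 ^ n\<close> comes from \<open>almost_all\<close>; rounding
      it up to \<open>2 ^ (n + m)\<close> merges it with the power of
      \<open>2 * K + 1\<close>.\<close>
    have "2 ^ n * (2 * K + 1) ^ (n + m) \<le> 2 ^ (n + m) * (2 * K + 1) ^ (n + m)"
      using K0 by (intro mult_right_mono power_increasing) auto
    also have "\<dots> = (2 * (2 * K + 1)) ^ (n + m)" by (simp only: power_mult_distrib)
    also have "\<dots> \<le> 2 * (2 * (2 * K + 1)) ^ (n + m)" using K0 by simp
    also note thr
    finally show "2 ^ n * (2 * K + 1) ^ (n + m) \<le> real M ^ m" .
  qed simp
  also have "\<dots> = real M ^ (m * n)"
    using n by (simp flip: power_add) (cases n; simp)
  finally show ?thesis unfolding almost_all_def card_G_mats by (simp add: field_simps)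
qed

text \<open>The same count with 0 as the only image, so that \<open>n\<close> takes the place of
  \<open>n + m\<close>. Fractions are now taken of \<open>G'_mats\<close>, and the hypothesis on
  \<open>chi\<close> limits the resulting loss to a factor 2.\<close>

lemma nullspace_almost_all:
  assumes m: "m \<ge> 1" and n: "n \<ge> 5" and "m \<le> n" and M1: "M \<ge> 1"
    and l: "l2 \<in> carrier_vec n" and w: "w2 \<in> carrier_vec n"
    and gap: "\<forall>j<n. l2 $ j < w2 $ j"
    and chi: "chi m n M \<ge> 1 / 2"
    and M: "real M > (2 powr ((real n - real m + 4) / 2)
      * vnorm (map_vec real_of_int (w2 - l2))) powr (real n / real m)"
  shows "almost_all n (G'_mats m n M) (nullspace_solved_at_rootnode l1 l2 w2)"
proof (cases "m = n")
  case True
  \<comment> \<open>An unsolved problem would force \<open>m < n\<close>, so for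
    \<open>m = n\<close> no matrix is bad.\<close>
  have "{A \<in> G'_mats m n M. \<not> nullspace_solved_at_rootnode l1 l2 w2 A} = {}"
    using nullspace_unsolved_imp_short[OF _ l w, of _ m l1] True
    unfolding G'_mats_def G_mats_def by blast
  then show ?thesis unfolding almost_all_def by (simp only: card.empty) simp
next
  case False
  then have mn: "m < n" using \<open>m \<le> n\<close> by simp
  define d where "d = map_vec real_of_int (w2 - l2)"
  define K where "K = radius (n - m) d"
  have "5 \<le> d \<bullet> d" using gap_sq_norm_ge[OF l w gap] n unfolding d_def by linarith
  then have K5: "sqrt 5 \<le> K" unfolding K_def by (rule radius_ge)
  then have K0: "0 \<le> K" using real_sqrt_ge_zero[of 5] by linarith
  have thr: "2 * (2 * (2 * K + 1)) ^ n \<le> real M ^ m"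
    using M n K5 m mn powr_radius[of "n - m" d] unfolding d_def[symmetric] K_def
    by (intro threshold_power_bound) (auto simp: of_nat_diff)
  let ?bad = "{A \<in> G'_mats m n M. \<not> nullspace_solved_at_rootnode l1 l2 w2 A}"
  let ?X = "int_box n K - {0\<^sub>v n}"
  have "card ?bad \<le> card ?X * card {0\<^sub>v m :: int vec} * M ^ (m * (n - 1))"
  proof (rule card_short_solutions)
    fix A assume "A \<in> ?bad"
    then have A: "A \<in> carrier_mat m n" and "\<not> nullspace_solved_at_rootnode l1 l2 w2 A"
      by (auto simp: G'_mats_def G_mats_def)
    then obtain x where "x \<in> carrier_vec n" "x \<noteq> 0\<^sub>v n" "A *\<^sub>v x = 0\<^sub>v m"
      "map_vec real_of_int x \<bullet> map_vec real_of_int x \<le> K\<^sup>2"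
      using nullspace_unsolved_imp_short[OF A l w] unfolding K_def radius_sq d_def by blast
    then show "\<exists>x\<in>?X. A *\<^sub>v x \<in> {0\<^sub>v m}" using K0 by (auto intro!: int_boxI)
  qed (use int_box_bound[OF K0] in \<open>auto simp: int_box_def G'_mats_def\<close>)
  also have "\<dots> \<le> card (int_box n K) * M ^ (m * (n - 1))"
    using int_box_bound[OF K0] by (auto intro!: mult_right_mono card_mono)
  finally have "real (card ?bad) \<le> real (card (int_box n K) * M ^ (m * (n - 1)))"
    by (simp only: of_nat_le_iff)
  also have "\<dots> \<le> (2 * K + 1) ^ n * real M ^ (m * (n - 1))"
    using int_box_bound[OF K0] by (auto intro!: mult_right_mono)
  \<comment> \<open>Of the two factors on the left, \<open>2 ^ n\<close> comes from
    \<open>almost_all\<close> and 2 prepares for the passage from \<open>G_mats\<close> to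
    \<open>G'_mats\<close>.\<close>
  finally have "2 * 2 ^ n * real (card ?bad) \<le> 2 * (2 * (2 * K + 1)) ^ n * real M ^ (m * (n - 1))"
    unfolding power_mult_distrib[of 2 "2 * K + 1"] by simp
  also have "\<dots> \<le> real M ^ m * real M ^ (m * (n - 1))"
    using thr by (rule mult_right_mono) simp
  also have "\<dots> = real M ^ (m * n)"
    using n by (simp flip: power_add) (cases n; simp)
  \<comment> \<open>This is \<open>chi \<ge> 1 / 2\<close> with the denominator cleared;
    \<open>M1\<close> makes that denominator positive.\<close>
  also have "\<dots> \<le> 2 * real (card (G'_mats m n M))"
    using chi M1 unfolding chi_def card_G_mats by (simp add: field_simps)
  finally show ?thesis unfolding almost_all_def by (simp add: field_simps)
qed

theorem theorem2:
  fixes m n M :: nat and l1 w1 l2 w2 :: "int vec"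
  assumes "m \<ge> 1" and "n \<ge> 5" and "M \<ge> 1"
    and "l1 \<in> carrier_vec m" and "w1 \<in> carrier_vec m"
    and "l2 \<in> carrier_vec n" and "w2 \<in> carrier_vec n"
    and "\<forall>j<n. l2 $ j < w2 $ j"
  shows
    "(real M > (2 powr ((real n + 4) / 2)
          * vnorm (map_vec real_of_int ((w1 @\<^sub>v w2) - (l1 @\<^sub>v l2))))
        powr (real n / real m + 1)
      \<longrightarrow> almost_all n (G_mats m n M) (rangespace_solved_at_rootnode l1 w1 l2 w2))
   \<and> (m \<le> n \<and> w1 = l1 \<and> chi m n M \<ge> 1 / 2
      \<and> real M > (2 powr ((real n - real m + 4) / 2)
          * vnorm (map_vec real_of_int (w2 - l2)))
        powr (real n / real m)
      \<longrightarrow> almost_all n (G'_mats m n M) (nullspace_solved_at_rootnode l1 l2 w2))"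
proof (intro conjI impI, goal_cases)
  case 1
  then show ?case by (rule rangespace_almost_all[OF assms(1,2,4,6,5,7,8)])
next
  case 2
  then show ?case using assms by (intro nullspace_almost_all) simp_all
qed

end
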